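(* For any $m,n\geq 2$, $\mathrm{MEG}(G(m,n))=2(m+n-2)$, where $G(m,n)=P_m\,\square\,P_n$ is the $m\times n$ grid graph.
   Context: $G(m,n)$ has vertex set $\{(i,j): 1\le i\le m,\ 1\le j\le n\}$, with $(i,j)$ and $(i',j')$ adjacent iff $|i-i'|+|j-j'|=1$. Two vertices $x,y$ of a graph $G$ monitor an edge $e$ if $e$ belongs to all shortest paths between $x$ and $y$. A set $S\subseteq V(G)$ is a monitoring edge-geodetic set (MEG-set) if for every edge $e$ of $G$ there is a pair $x,y\in S$ that monitors $e$. $\mathrm{MEG}(G)$ denotes the minimum size of an MEG-set of $G$. *)

theory Defs
  imports Main
begin

record 'a ugraph =
  verts :: "'a set"
  edges :: "'a set set"

definition walk_edges :: "'a list \<Rightarrow> 'a set set" where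
  "walk_edges p = {{p ! i, p ! Suc i} | i. Suc i < length p}"

definition is_path :: "'a ugraph \<Rightarrow> 'a \<Rightarrow> 'a \<Rightarrow> 'a list \<Rightarrow> bool" where
  "is_path G x y p \<longleftrightarrow>
     p \<noteq> [] \<and> hd p = x \<and> last p = y \<and> distinct p \<and>
     set p \<subseteq> verts G \<and> walk_edges p \<subseteq> edges G"

definition is_shortest_path :: "'a ugraph \<Rightarrow> 'a \<Rightarrow> 'a \<Rightarrow> 'a list \<Rightarrow> bool" where
  "is_shortest_path G x y p \<longleftrightarrow>
     is_path G x y p \<and> (\<forall>q. is_path G x y q \<longrightarrow> length p \<le> length q)"

text \<open>
  The condition is vacuously true for \<open>x\<close> and \<open>y\<close> in different components,
  so these notions are meant for connected graphs.
\<close>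

definition monitors :: "'a ugraph \<Rightarrow> 'a \<Rightarrow> 'a \<Rightarrow> 'a set \<Rightarrow> bool" where
  "monitors G x y e \<longleftrightarrow> (\<forall>p. is_shortest_path G x y p \<longrightarrow> e \<in> walk_edges p)"

definition is_MEG_set :: "'a ugraph \<Rightarrow> 'a set \<Rightarrow> bool" where
  "is_MEG_set G S \<longleftrightarrow>
     S \<subseteq> verts G \<and> (\<forall>e\<in>edges G. \<exists>x\<in>S. \<exists>y\<in>S. monitors G x y e)"

text \<open>For a finite graph the minimum exists, since \<open>verts G\<close> is itself an MEG-set.\<close>

definition MEG :: "'a ugraph \<Rightarrow> nat" where
  "MEG G = (LEAST k. \<exists>S. is_MEG_set G S \<and> finite S \<and> card S = k)"

definition grid :: "nat \<Rightarrow> nat \<Rightarrow> (nat \<times> nat) ugraph" where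
  "grid m n =
     \<lparr> verts = {1..m} \<times> {1..n},
       edges = {{(i, j), (i', j')} | i j i' j'.
                  (i, j) \<in> {1..m} \<times> {1..n} \<and> (i', j') \<in> {1..m} \<times> {1..n} \<and>
                  \<bar>int i - int i'\<bar> + \<bar>int j - int j'\<bar> = 1} \<rparr>"

end

theory Submission imports Defs begin

text \<open>
  Between two vertices that differ in both coordinates there are two L-shaped shortest paths, and
  these meet only in their end points; so a monitoring pair lies in one row or column, with the
  monitored edge between its two members. The edge leading from a boundary vertex
  perpendicularly into the grid therefore forces this vertex into every MEG-set. Conversely
  opposite ends of a row or column are joined by a unique shortest path, so the boundary is an MEG-set.
\<close>

section \<open>The Manhattan metric on the grid\<close>

definition grid_dist :: "nat \<times> nat \<Rightarrow> nat \<times> nat \<Rightarrow> int" where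
  "grid_dist x y = \<bar>int (fst x) - int (fst y)\<bar> + \<bar>int (snd x) - int (snd y)\<bar>"

text \<open>Written as the rectangle minus its interior so that its size is a difference of two
  products. If \<open>m = 2\<close> or \<open>n = 2\<close>, the interior is empty and every vertex
  is a boundary vertex.\<close>

definition grid_boundary :: "nat \<Rightarrow> nat \<Rightarrow> (nat \<times> nat) set" where
  "grid_boundary m n = {1..m} \<times> {1..n} - {2..m-1} \<times> {2..n-1}"

lemma verts_grid: "verts (grid m n) = {1..m} \<times> {1..n}"
  by (simp add: grid_def)

lemma edges_grid:
  "edges (grid m n) =
     {{u, v} | u v. u \<in> verts (grid m n) \<and> v \<in> verts (grid m n) \<and> grid_dist u v = 1}"
  by (auto simp: grid_def grid_dist_def)

lemma grid_dist_commute: "grid_dist x y = grid_dist y x"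
  by (simp add: grid_dist_def)

lemma grid_dist_triangle: "grid_dist x z \<le> grid_dist x y + grid_dist y z"
  by (simp add: grid_dist_def)

lemma grid_dist_nonneg: "0 \<le> grid_dist x y"
  by (simp add: grid_dist_def)

lemma grid_dist_eq_0_iff: "grid_dist x y = 0 \<longleftrightarrow> x = y"
  by (auto simp: grid_dist_def prod_eq_iff)

section \<open>Edges of walks given as lists\<close>

lemma walk_edges_singleton: "walk_edges [x] = {}"
  by (simp add: walk_edges_def)

lemma walk_edges_Cons:
  assumes "p \<noteq> []"
  shows "walk_edges (x # p) = insert {x, hd p} (walk_edges p)"
proof -
  have "walk_edges (x # p) = {{(x # p) ! i, p ! i} | i. i < length p}"
    by (auto simp: walk_edges_def)
  also have "\<dots> = insert {x, hd p} (walk_edges p)" (is "?L = ?R")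
  proof
    show "?L \<subseteq> ?R"
    proof
      fix e assume "e \<in> ?L"
      then obtain i where "e = {(x # p) ! i, p ! i}" "i < length p" by blast
      then show "e \<in> ?R"
        using assms by (cases i) (auto simp: walk_edges_def hd_conv_nth)
    qed
    show "?R \<subseteq> ?L"
    proof
      fix e assume "e \<in> ?R"
      then consider "e = {x, p ! 0}" | i where "e = {p ! i, p ! Suc i}" "Suc i < length p"
        using assms by (auto simp: walk_edges_def hd_conv_nth)
      then show "e \<in> ?L"
      proof cases
        case 1
        then show ?thesis using assms by (force intro!: exI[of _ 0])
      next
        case (2 i)
        then show ?thesis by (force intro!: exI[of _ "Suc i"])
      qed
    qed
  qed
  finally show ?thesis .
qed

lemma walk_edges_subset_set: "e \<in> walk_edges p \<Longrightarrow> e \<subseteq> set p"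
  by (auto simp: walk_edges_def)

section \<open>Path lengths versus grid distance\<close>

lemma grid_path_dist_nth_le:
  assumes "is_path (grid m n) x y p" "s + k < length p"
  shows "grid_dist (p ! s) (p ! (s + k)) \<le> int k"
  using assms(2)
proof (induction k)
  case 0
  then show ?case by (simp add: grid_dist_def)
next
  case (Suc k)
  have "{p ! (s + k), p ! Suc (s + k)} \<in> walk_edges p"
    using Suc.prems by (auto simp: walk_edges_def)
  then have "{p ! (s + k), p ! Suc (s + k)} \<in> edges (grid m n)"
    using assms(1) by (auto simp: is_path_def)
  then have "grid_dist (p ! (s + k)) (p ! Suc (s + k)) = 1"
    unfolding edges_grid by (auto simp: doubleton_eq_iff grid_dist_commute)
  then show ?case
    using Suc grid_dist_triangle[of "p ! s" "p ! Suc (s + k)" "p ! (s + k)"] by simp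
qed

text \<open>If \<open>p\<close> has \<open>grid_dist x y + 1\<close> vertices, the two bounds add up
  to \<open>grid_dist x y\<close>, so by the triangle inequality both are equalities. This locates
  every vertex of a shortest path along a row or column.\<close>

lemma grid_path_dist_ends_nth_le:
  assumes "is_path (grid m n) x y p" "s < length p"
  shows "grid_dist x (p ! s) \<le> int s" "grid_dist (p ! s) y \<le> int (length p) - 1 - int s"
proof -
  have "p \<noteq> []" "p ! 0 = x" "p ! (length p - 1) = y"
    using assms(1) by (auto simp: is_path_def hd_conv_nth last_conv_nth)
  then show "grid_dist x (p ! s) \<le> int s" "grid_dist (p ! s) y \<le> int (length p) - 1 - int s"
    using assms(2) grid_path_dist_nth_le[OF assms(1), of 0 s]
      grid_path_dist_nth_le[OF assms(1), of s "length p - 1 - s"]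
    by auto
qed

lemma grid_path_length_ge:
  assumes "is_path (grid m n) x y p"
  shows "grid_dist x y + 1 \<le> int (length p)"
proof -
  have "0 < length p" "p ! 0 = x"
    using assms by (auto simp: is_path_def hd_conv_nth)
  then show ?thesis
    using grid_path_dist_ends_nth_le(2)[OF assms, of 0] by simp
qed

text \<open>Greedy descent: each step inside \<open>T\<close> brings the walk one closer to
  \<open>y\<close>, so it arrives after \<open>grid_dist x y\<close> steps. Building a geodesic is
  thus reduced to choosing the next vertex.\<close>

lemma geodesic_within_descending_set:
  assumes T: "T \<subseteq> verts (grid m n)"
    and step: "\<And>v. v \<in> T \<Longrightarrow> v \<noteq> y \<Longrightarrow>
      \<exists>w\<in>T. grid_dist v w = 1 \<and> grid_dist w y = grid_dist v y - 1"
    and "x \<in> T"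
  shows "\<exists>p. is_path (grid m n) x y p \<and> int (length p) = grid_dist x y + 1 \<and> set p \<subseteq> T"
proof -
  \<comment> \<open>The last conjunct strengthens the induction: a new first vertex is farther from
    \<open>y\<close> than all vertices of the old path, so the extended path stays distinct.\<close>
  have "\<exists>p. is_path (grid m n) v y p \<and> int (length p) = grid_dist v y + 1 \<and> set p \<subseteq> T \<and>
      (\<forall>u\<in>set p. grid_dist u y \<le> grid_dist v y)"
    if "v \<in> T" "grid_dist v y = int k" for v k
    using that
  proof (induction k arbitrary: v)
    case 0
    then have "v = y" by (simp add: grid_dist_eq_0_iff)
    with 0 T show ?case
      by (intro exI[of _ "[y]"]) (auto simp: is_path_def walk_edges_singleton)
  next
    case (Suc k)
    then have "v \<noteq> y" using grid_dist_eq_0_iff[of v y] by auto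
    with step Suc.prems obtain w where w: "w \<in> T" "grid_dist v w = 1" "grid_dist w y = int k"
      by fastforce
    with Suc.IH obtain p where p: "is_path (grid m n) w y p" "int (length p) = int k + 1"
      "set p \<subseteq> T" "\<And>u. u \<in> set p \<Longrightarrow> grid_dist u y \<le> int k"
      by metis
    have "v \<notin> set p" using p(4)[of v] Suc.prems by auto
    moreover have "{v, w} \<in> edges (grid m n)"
      unfolding edges_grid using w Suc.prems T by blast
    ultimately have "is_path (grid m n) v y (v # p)"
      using p(1) T Suc.prems by (auto simp: is_path_def walk_edges_Cons)
    then show ?case
      using p Suc.prems by (intro exI[of _ "v # p"]) fastforce
  qed
  from this[of x "nat (grid_dist x y)"] \<open>x \<in> T\<close> grid_dist_nonneg show ?thesis by auto
qed

section \<open>The two L-shaped geodesics and monitoring pairs\<close>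

definition L_shape_col :: "nat \<times> nat \<Rightarrow> nat \<times> nat \<Rightarrow> (nat \<times> nat) set" where
  "L_shape_col x y =
     {min (fst x) (fst y)..max (fst x) (fst y)} \<times> {snd x} \<union>
     {fst y} \<times> {min (snd x) (snd y)..max (snd x) (snd y)}"

text \<open>Both L-shapes are vertex sets and not lists, so that \<open>min\<close> and
  \<open>max\<close> absorb the possible directions from \<open>x\<close> to \<open>y\<close>. This
  one turns at the corner opposite to that of \<open>L_shape_col\<close>.\<close>

definition L_shape_row :: "nat \<times> nat \<Rightarrow> nat \<times> nat \<Rightarrow> (nat \<times> nat) set" where
  "L_shape_row x y =
     {fst x} \<times> {min (snd x) (snd y)..max (snd x) (snd y)} \<union>
     {min (fst x) (fst y)..max (fst x) (fst y)} \<times> {snd y}"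

lemma geodesic_within_L_shape_col:
  assumes "x \<in> verts (grid m n)" "y \<in> verts (grid m n)"
  shows "\<exists>p. is_path (grid m n) x y p \<and> int (length p) = grid_dist x y + 1 \<and> set p \<subseteq> L_shape_col x y"
proof (rule geodesic_within_descending_set)
  show "L_shape_col x y \<subseteq> verts (grid m n)"
    using assms by (auto simp: L_shape_col_def verts_grid)
  show "x \<in> L_shape_col x y" by (cases x) (auto simp: L_shape_col_def)
  fix v assume v: "v \<in> L_shape_col x y" "v \<noteq> y"
  obtain i j where ij: "v = (i, j)" by fastforce
  obtain a b c d where xy: "x = (a, b)" "y = (c, d)" by fastforce
  \<comment> \<open>A vertex with \<open>i \<noteq> c\<close> lies on the leg through
    \<open>x\<close>, where the first coordinate is corrected. The last branch is reached only for
    \<open>d < j\<close>, since \<open>v \<noteq> y\<close>, so \<open>j - 1\<close> is a true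
    predecessor.\<close>
  define w where "w = (if i < c then (Suc i, j) else if c < i then (i - 1, j)
    else if j < d then (i, Suc j) else (i, j - 1))"
  have "w \<in> L_shape_col x y \<and> grid_dist v w = 1 \<and> grid_dist w y = grid_dist v y - 1"
    using v unfolding w_def ij xy L_shape_col_def grid_dist_def
    by (auto split: if_splits)
  then show "\<exists>w\<in>L_shape_col x y. grid_dist v w = 1 \<and> grid_dist w y = grid_dist v y - 1" by blast
qed

lemma geodesic_within_L_shape_row:
  assumes "x \<in> verts (grid m n)" "y \<in> verts (grid m n)"
  shows "\<exists>p. is_path (grid m n) x y p \<and> int (length p) = grid_dist x y + 1 \<and> set p \<subseteq> L_shape_row x y"
proof (rule geodesic_within_descending_set)
  show "L_shape_row x y \<subseteq> verts (grid m n)"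
    using assms by (auto simp: L_shape_row_def verts_grid)
  show "x \<in> L_shape_row x y" by (cases x) (auto simp: L_shape_row_def)
  fix v assume v: "v \<in> L_shape_row x y" "v \<noteq> y"
  obtain i j where ij: "v = (i, j)" by fastforce
  obtain a b c d where xy: "x = (a, b)" "y = (c, d)" by fastforce
  define w where "w = (if j < d then (i, Suc j) else if d < j then (i, j - 1)
    else if i < c then (Suc i, j) else (i - 1, j))"
  have "w \<in> L_shape_row x y \<and> grid_dist v w = 1 \<and> grid_dist w y = grid_dist v y - 1"
    using v unfolding w_def ij xy L_shape_row_def grid_dist_def
    by (auto split: if_splits)
  then show "\<exists>w\<in>L_shape_row x y. grid_dist v w = 1 \<and> grid_dist w y = grid_dist v y - 1" by blast
qed

text \<open>The lower bound \<open>grid_path_length_ge\<close> is attained by an L-shape, so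
  \<open>grid_dist\<close> is the graph distance and minimality becomes an equation for the
  length.\<close>

lemma grid_shortest_path_iff:
  assumes "x \<in> verts (grid m n)" "y \<in> verts (grid m n)"
  shows "is_shortest_path (grid m n) x y p \<longleftrightarrow>
    is_path (grid m n) x y p \<and> int (length p) = grid_dist x y + 1"
proof -
  obtain q where "is_path (grid m n) x y q" "int (length q) = grid_dist x y + 1"
    using geodesic_within_L_shape_col[OF assms] by blast
  then show ?thesis
    unfolding is_shortest_path_def using grid_path_length_ge by fastforce
qed

lemma grid_monitors_subset_L_shapes:
  assumes "x \<in> verts (grid m n)" "y \<in> verts (grid m n)" "monitors (grid m n) x y e"
  shows "e \<subseteq> L_shape_col x y \<inter> L_shape_row x y"
proof -
  obtain p q where "is_shortest_path (grid m n) x y p" "set p \<subseteq> L_shape_col x y"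
    "is_shortest_path (grid m n) x y q" "set q \<subseteq> L_shape_row x y"
    using geodesic_within_L_shape_col[OF assms(1,2)] geodesic_within_L_shape_row[OF assms(1,2)]
      grid_shortest_path_iff[OF assms(1,2)] by blast
  then show ?thesis
    using assms(3) walk_edges_subset_set unfolding monitors_def by blast
qed

text \<open>If \<open>x\<close> and \<open>y\<close> differ in both coordinates, the L-shapes share
  only \<open>x\<close> and \<open>y\<close>, which are not adjacent. Otherwise both are the
  straight segment from \<open>x\<close> to \<open>y\<close>, and it contains a column edge only if
  it runs along that column.\<close>

lemma L_shapes_column_edge:
  assumes "{(i, j), (Suc i, j)} \<subseteq> L_shape_col x y \<inter> L_shape_row x y"
  shows "snd x = j \<and> snd y = j \<and> min (fst x) (fst y) \<le> i \<and> Suc i \<le> max (fst x) (fst y)"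
  using assms by (cases x; cases y) (auto simp: L_shape_col_def L_shape_row_def)

lemma L_shapes_row_edge:
  assumes "{(i, j), (i, Suc j)} \<subseteq> L_shape_col x y \<inter> L_shape_row x y"
  shows "fst x = i \<and> fst y = i \<and> min (snd x) (snd y) \<le> j \<and> Suc j \<le> max (snd x) (snd y)"
  using assms by (cases x; cases y) (auto simp: L_shape_col_def L_shape_row_def)

section \<open>Every MEG-set contains the boundary\<close>

lemma MEG_set_column_edge:
  assumes S: "is_MEG_set (grid m n) S" and ij: "1 \<le> i" "i < m" "1 \<le> j" "j \<le> n"
  shows "\<exists>a b. (a, j) \<in> S \<and> (b, j) \<in> S \<and> 1 \<le> a \<and> a \<le> i \<and> i < b \<and> b \<le> m"
proof -
  have "{(i, j), (Suc i, j)} \<in> edges (grid m n)"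
    unfolding edges_grid using ij
    by (intro CollectI exI[of _ "(i, j)"] exI[of _ "(Suc i, j)"])
      (auto simp: verts_grid grid_dist_def)
  then obtain x y where xy: "x \<in> S" "y \<in> S" "monitors (grid m n) x y {(i, j), (Suc i, j)}"
    using S unfolding is_MEG_set_def by blast
  moreover have V: "x \<in> verts (grid m n)" "y \<in> verts (grid m n)"
    using xy S unfolding is_MEG_set_def by auto
  ultimately have "snd x = j \<and> snd y = j \<and> min (fst x) (fst y) \<le> i \<and> Suc i \<le> max (fst x) (fst y)"
    by (intro L_shapes_column_edge grid_monitors_subset_L_shapes)
  with xy V show ?thesis
    by (cases x; cases y) (auto simp: verts_grid min_le_iff_disj le_max_iff_disj Suc_le_eq)
qed

lemma MEG_set_row_edge:
  assumes S: "is_MEG_set (grid m n) S" and ij: "1 \<le> i" "i \<le> m" "1 \<le> j" "j < n"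
  shows "\<exists>a b. (i, a) \<in> S \<and> (i, b) \<in> S \<and> 1 \<le> a \<and> a \<le> j \<and> j < b \<and> b \<le> n"
proof -
  have "{(i, j), (i, Suc j)} \<in> edges (grid m n)"
    unfolding edges_grid using ij
    by (intro CollectI exI[of _ "(i, j)"] exI[of _ "(i, Suc j)"])
      (auto simp: verts_grid grid_dist_def)
  then obtain x y where xy: "x \<in> S" "y \<in> S" "monitors (grid m n) x y {(i, j), (i, Suc j)}"
    using S unfolding is_MEG_set_def by blast
  moreover have V: "x \<in> verts (grid m n)" "y \<in> verts (grid m n)"
    using xy S unfolding is_MEG_set_def by auto
  ultimately have "fst x = i \<and> fst y = i \<and> min (snd x) (snd y) \<le> j \<and> Suc j \<le> max (snd x) (snd y)"
    by (intro L_shapes_row_edge grid_monitors_subset_L_shapes)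
  with xy V show ?thesis
    by (cases x; cases y) (auto simp: verts_grid min_le_iff_disj le_max_iff_disj Suc_le_eq)
qed

text \<open>A boundary vertex is an end of some row or column. The line's edge at this vertex has no
  other vertex of the line on that side, so the member of \<open>S\<close> required there is the
  vertex itself.\<close>

lemma grid_boundary_subset_MEG_set:
  assumes "m \<ge> 2" "n \<ge> 2" "is_MEG_set (grid m n) S"
  shows "grid_boundary m n \<subseteq> S"
proof
  fix v assume "v \<in> grid_boundary m n"
  moreover obtain i j where v: "v = (i, j)" by fastforce
  ultimately have ij: "1 \<le> i" "i \<le> m" "1 \<le> j" "j \<le> n" and "i = 1 \<or> i = m \<or> j = 1 \<or> j = n"
    by (auto simp: grid_boundary_def)
  then consider "i = 1" | "i = m" | "j = 1" | "j = n" by blast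
  then show "v \<in> S"
  proof cases
    case 1
    then show ?thesis
      using MEG_set_column_edge[OF assms(3), of 1 j] assms(1) ij v by (auto dest: le_antisym)
  next
    case 2
    obtain b where "(b, j) \<in> S" "m - 1 < b" "b \<le> m"
      using MEG_set_column_edge[OF assms(3), of "m - 1" j] assms(1) ij by fastforce
    moreover from this have "b = m" by simp
    ultimately show ?thesis using 2 v by simp
  next
    case 3
    then show ?thesis
      using MEG_set_row_edge[OF assms(3), of i 1] assms(2) ij v by (auto dest: le_antisym)
  next
    case 4
    obtain b where "(i, b) \<in> S" "n - 1 < b" "b \<le> n"
      using MEG_set_row_edge[OF assms(3), of i "n - 1"] assms(2) ij by fastforce
    moreover from this have "b = n" by simp
    ultimately show ?thesis using 4 v by simp
  qed
qed

section \<open>The boundary is an MEG-set\<close>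

lemma column_ends_monitor:
  assumes "1 \<le> i" "i < m" "1 \<le> j" "j \<le> n"
  shows "monitors (grid m n) (1, j) (m, j) {(i, j), (Suc i, j)}"
  unfolding monitors_def
proof (intro allI impI)
  fix p assume "is_shortest_path (grid m n) (1, j) (m, j) p"
  then have p: "is_path (grid m n) (1, j) (m, j) p" and "int (length p) = grid_dist (1, j) (m, j) + 1"
    using assms by (auto simp: grid_shortest_path_iff verts_grid)
  then have len: "length p = m" using assms by (simp add: grid_dist_def)
  \<comment> \<open>The distances to the two ends are at most \<open>s\<close> and
    \<open>m - 1 - s\<close>, which forces the first coordinate and leaves nothing for the second.
    List positions start at 0 and coordinates at 1, so the edge sits at position
    \<open>i - 1\<close>.\<close>
  have "p ! s = (Suc s, j)" if "s < m" for s
    using grid_path_dist_ends_nth_le[OF p, of s] that len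
    by (cases "p ! s") (auto simp: grid_dist_def)
  from this[of "i - 1"] this[of i] assms len show "{(i, j), (Suc i, j)} \<in> walk_edges p"
    unfolding walk_edges_def by (intro CollectI exI[of _ "i - 1"]) auto
qed

lemma row_ends_monitor:
  assumes "1 \<le> i" "i \<le> m" "1 \<le> j" "j < n"
  shows "monitors (grid m n) (i, 1) (i, n) {(i, j), (i, Suc j)}"
  unfolding monitors_def
proof (intro allI impI)
  fix p assume "is_shortest_path (grid m n) (i, 1) (i, n) p"
  then have p: "is_path (grid m n) (i, 1) (i, n) p" and "int (length p) = grid_dist (i, 1) (i, n) + 1"
    using assms by (auto simp: grid_shortest_path_iff verts_grid)
  then have len: "length p = n" using assms by (simp add: grid_dist_def)
  have "p ! s = (i, Suc s)" if "s < n" for s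
    using grid_path_dist_ends_nth_le[OF p, of s] that len
    by (cases "p ! s") (auto simp: grid_dist_def)
  from this[of "j - 1"] this[of j] assms len show "{(i, j), (i, Suc j)} \<in> walk_edges p"
    unfolding walk_edges_def by (intro CollectI exI[of _ "j - 1"]) auto
qed

text \<open>Edges are unordered pairs, so naming the end with the smaller coordinate first merges
  four neighbour directions into two cases.\<close>

lemma grid_edge_cases:
  assumes "e \<in> edges (grid m n)"
  obtains (column) i j where "e = {(i, j), (Suc i, j)}" "1 \<le> i" "i < m" "1 \<le> j" "j \<le> n"
    | (row) i j where "e = {(i, j), (i, Suc j)}" "1 \<le> i" "i \<le> m" "1 \<le> j" "j < n"
proof -
  obtain a b c d where e: "e = {(a, b), (c, d)}" "a \<in> {1..m}" "b \<in> {1..n}" "c \<in> {1..m}" "d \<in> {1..n}"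
    and "\<bar>int a - int c\<bar> + \<bar>int b - int d\<bar> = 1"
    using assms by (auto simp: grid_def)
  then consider "c = Suc a \<and> b = d" | "a = Suc c \<and> b = d" | "a = c \<and> d = Suc b" | "a = c \<and> b = Suc d"
    by linarith
  then show thesis
  proof cases
    case 1
    with e show ?thesis by (intro column[of a b]) auto
  next
    case 2
    with e show ?thesis by (intro column[of c b]) auto
  next
    case 3
    with e show ?thesis by (intro row[of a b]) auto
  next
    case 4
    with e show ?thesis by (intro row[of a d]) auto
  qed
qed

lemma grid_boundary_is_MEG_set:
  assumes "m \<ge> 2" "n \<ge> 2"
  shows "is_MEG_set (grid m n) (grid_boundary m n)"
  unfolding is_MEG_set_def
proof (intro conjI ballI)
  show "grid_boundary m n \<subseteq> verts (grid m n)"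
    by (auto simp: grid_boundary_def verts_grid)
  fix e assume "e \<in> edges (grid m n)"
  then show "\<exists>x\<in>grid_boundary m n. \<exists>y\<in>grid_boundary m n. monitors (grid m n) x y e"
  proof (cases rule: grid_edge_cases)
    case (column i j)
    then have "(1, j) \<in> grid_boundary m n" "(m, j) \<in> grid_boundary m n"
      using assms by (auto simp: grid_boundary_def)
    with column column_ends_monitor show ?thesis by blast
  next
    case (row i j)
    then have "(i, 1) \<in> grid_boundary m n" "(i, n) \<in> grid_boundary m n"
      using assms by (auto simp: grid_boundary_def)
    with row row_ends_monitor show ?thesis by blast
  qed
qed

section \<open>Size of the boundary and the minimum\<close>

lemma card_grid_boundary:
  assumes "m \<ge> 2" "n \<ge> 2"
  shows "card (grid_boundary m n) = 2 * (m + n - 2)"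
proof -
  \<comment> \<open>This removes truncated subtraction: the claim becomes
    \<open>(k + 2) * (l + 2) - k * l = 2 * (k + l + 2)\<close>.\<close>
  obtain k l where kl: "m = k + 2" "n = l + 2"
    using assms by (metis add.commute le_Suc_ex)
  have "card (grid_boundary m n) = card ({1..m} \<times> {1..n}) - card ({2..m-1} \<times> {2..n-1})"
    unfolding grid_boundary_def by (rule card_Diff_subset) auto
  also have "\<dots> = 2 * (m + n - 2)"
    using kl by (simp add: card_cartesian_product algebra_simps)
  finally show ?thesis .
qed

theorem theorem7:
  fixes m n :: nat
  assumes "m \<ge> 2" and "n \<ge> 2"
  shows "MEG (grid m n) = 2 * (m + n - 2)"
  unfolding MEG_def
proof (rule Least_equality)
  have "finite (grid_boundary m n)" by (simp add: grid_boundary_def)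
  with assms show "\<exists>S. is_MEG_set (grid m n) S \<and> finite S \<and> card S = 2 * (m + n - 2)"
    using grid_boundary_is_MEG_set card_grid_boundary by blast
next
  fix k assume "\<exists>S. is_MEG_set (grid m n) S \<and> finite S \<and> card S = k"
  \<comment> \<open>\<open>card_mono\<close> relies on the finiteness of \<open>S\<close>, since an
    infinite set has \<open>card\<close> equal to 0.\<close>
  then show "2 * (m + n - 2) \<le> k"
    using assms grid_boundary_subset_MEG_set card_grid_boundary by (metis card_mono)
qed

end
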